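(* (a) Suppose $\beta\ge 4$. Then $E_{2,\beta}(x)>0$ for every $x\in\mathbb{R}$. In particular, the function $E_{2,\beta}$ has only non-real zeros, and the inequality $|E_{2,\beta}(z)|\ge E_{2,\beta}(\Re z)$ does not hold for all $z\in\mathbb{C}$. (b) Suppose $\beta\in(3,4)$. Then the function $E_{2,\beta}$ has a finite number of negative zeros, and the inequality $|E_{2,\beta}(z)|\ge E_{2,\beta}(\Re z)$ does not hold for all $z\in\mathbb{C}$.
   Context: For $\beta\in\mathbb{R}$, $E_{2,\beta}$ is the Mittag-Leffler function $E_{2,\beta}(z)=\sum_{k=0}^{\infty}\frac{z^k}{\Gamma(2k+\beta)}$, $z\in\mathbb{C}$. $\Re z$ denotes the real part of $z$. *)

theory Defs
  imports "HOL-Analysis.Gamma_Function"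
begin

text \<open>
  The library sets \<open>Gamma x = 0\<close> at the poles and \<open>w / 0 = 0\<close>, so a term with
  \<open>2k + \<beta>\<close> a nonpositive integer vanishes, in accordance with the convention
  \<open>1/\<Gamma> = 0\<close> at the poles of \<open>\<Gamma>\<close>.
\<close>
definition mittag_leffler2 :: "real \<Rightarrow> complex \<Rightarrow> complex" where
  "mittag_leffler2 \<beta> z = (\<Sum>k. z ^ k / of_real (Gamma (2 * real k + \<beta>)))"

end

theory Submission
  imports Defs "HOL-Real_Asymp.Real_Asymp"
begin

text \<open>
  For \<open>\<beta> > 3\<close> the Beta integral, applied termwise to the series of \<open>1 - cos\<close>, gives
  \<open>\<Gamma>(\<beta> - 3) y\<^sup>2 E(-y\<^sup>2) = \<integral>\<^sub>0\<^sup>1 (1 - u)\<^bsup>\<beta> - 4\<^esup> (1 - cos (y u)) du\<close>, where \<open>E\<close> is the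
  Mittag-Leffler function. Hence \<open>E\<close> is positive on the whole real line and decays on the
  negative half-line no faster than \<open>1/|x|\<close>; in case (b) there are thus no negative zeros at all.
  If \<open>|E(z)| \<ge> E(Re z)\<close> held everywhere, then \<open>ln E\<close> would be concave on the real line. As \<open>E\<close> is
  increasing at \<open>0\<close>, it would decay exponentially at \<open>-\<infinity>\<close>, a contradiction.
\<close>

section \<open>Series coefficients and convergence\<close>

definition ml_coeff :: "real \<Rightarrow> nat \<Rightarrow> real" where
  "ml_coeff \<beta> k = inverse (Gamma (2 * real k + \<beta>))"

definition real_ml :: "real \<Rightarrow> real \<Rightarrow> real" where
  "real_ml \<beta> x = (\<Sum>k. ml_coeff \<beta> k * x ^ k)"

lemma ml_coeff_pos: "\<beta> > 0 \<Longrightarrow> ml_coeff \<beta> k > 0"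
  by (simp add: ml_coeff_def add_nonneg_pos)

text \<open>Two applications of \<Gamma>(s + 1) = s \<Gamma>(s) at s = 2k + \<beta>; this recurrence
  drives the ratio test for the series.\<close>

lemma ml_coeff_Suc:
  assumes "\<beta> > 0"
  shows "ml_coeff \<beta> k = (2 * real k + \<beta>) * (2 * real k + \<beta> + 1) * ml_coeff \<beta> (Suc k)"
proof -
  define s where "s = 2 * real k + \<beta>"
  have s: "s > 0" using assms by (simp add: s_def add_nonneg_pos)
  have "Gamma (s + 2) = (s + 1) * Gamma (s + 1)"
    using Gamma_plus1[of "s + 1"] s nonpos_Ints_nonpos[of "s + 1"] by (force simp: add.assoc)
  also have "Gamma (s + 1) = s * Gamma s"
    using Gamma_plus1[of s] s nonpos_Ints_nonpos[of s] by force
  finally have "Gamma (s + 2) = (s + 1) * s * Gamma s" by simp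
  moreover have "2 * real (Suc k) + \<beta> = s + 2" by (simp add: s_def)
  ultimately have "ml_coeff \<beta> (Suc k) = inverse ((s + 1) * s * Gamma s)"
    by (simp only: ml_coeff_def)
  moreover have "s * (s + 1) * inverse ((s + 1) * s * Gamma s) = inverse (Gamma s)"
    using s by (simp add: divide_simps)
  ultimately show ?thesis
    unfolding ml_coeff_def[of \<beta> k] s_def[symmetric] by simp
qed

text \<open>The ratio of consecutive terms is |z| / ((2n + \<beta>)(2n + \<beta> + 1)), which tends
  to 0. The type is left general because both the real and the complex series are needed.\<close>

lemma summable_ml:
  fixes z :: "'a :: {real_normed_field, banach}"
  assumes "\<beta> > 0"
  shows "summable (\<lambda>k. of_real (ml_coeff \<beta> k) * z ^ k)"
proof (rule summable_ratio_test[of "1/2" "nat \<lceil>norm z\<rceil> + 1"])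
  fix n assume n: "n \<ge> nat \<lceil>norm z\<rceil> + 1"
  have zn: "norm z \<le> real n" "real n \<ge> 1" using n by linarith+
  have pos: "ml_coeff \<beta> (Suc n) > 0" using assms by (rule ml_coeff_pos)
  \<comment> \<open>For n \<ge> |z| and n \<ge> 1 the first factor of the denominator already
    dominates 2|z|, and the second is at least 1; hence the ratio 1/2.\<close>
  have "2 * norm z \<le> 2 * real n * 1" using zn by simp
  also have "\<dots> \<le> (2 * real n + \<beta>) * (2 * real n + \<beta> + 1)"
    using assms zn by (intro mult_mono) auto
  finally have "2 * norm z * ml_coeff \<beta> (Suc n) * norm z ^ n
      \<le> (2 * real n + \<beta>) * (2 * real n + \<beta> + 1) * ml_coeff \<beta> (Suc n) * norm z ^ n"
    using pos by (intro mult_right_mono) auto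
  also have "\<dots> = ml_coeff \<beta> n * norm z ^ n"
    by (subst ml_coeff_Suc[OF assms, of n]) simp
  finally show "norm (of_real (ml_coeff \<beta> (Suc n)) * z ^ Suc n)
      \<le> 1/2 * norm (of_real (ml_coeff \<beta> n) * z ^ n)"
    using ml_coeff_pos[OF assms] by (simp add: norm_mult norm_power abs_of_pos mult_ac)
qed simp

lemma mittag_leffler2_eq:
  "mittag_leffler2 \<beta> z = (\<Sum>k. of_real (ml_coeff \<beta> k) * z ^ k)"
  by (simp add: mittag_leffler2_def ml_coeff_def field_simps)

lemma mittag_leffler2_of_real:
  assumes "\<beta> > 0"
  shows "mittag_leffler2 \<beta> (of_real x) = of_real (real_ml \<beta> x)"
  using suminf_of_real[OF summable_ml[OF assms, of x, simplified], where ?'a = complex]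
  by (simp add: mittag_leffler2_eq real_ml_def)

lemma real_ml_pos_nonneg:
  assumes "\<beta> > 0" "x \<ge> 0"
  shows "real_ml \<beta> x > 0"
  unfolding real_ml_def
proof (rule suminf_pos2[of _ 0])
  show "summable (\<lambda>k. ml_coeff \<beta> k * x ^ k)"
    using summable_ml[OF assms(1), of x] by simp
qed (use assms in \<open>auto simp: ml_coeff_pos less_imp_le\<close>)

section \<open>Integral representation on the negative half-line\<close>

lemma one_minus_cos_sums: "(\<lambda>k. (-1) ^ k * v ^ (2 * k + 2) / fact (2 * k + 2)) sums (1 - cos (v::real))"
proof -
  have "(\<lambda>k. (- 1) ^ Suc k / fact (2 * Suc k) * v ^ (2 * Suc k)) sums (cos v - 1)"
    by (subst sums_Suc_iff) (use cos_paired[of v] in simp)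
  from sums_minus[OF this] show ?thesis
    by (simp add: mult.commute del: fact_Suc)
qed

text \<open>This is the Beta integral B(2k + 3, \<beta> - 3) = \<Gamma>(2k + 3) \<Gamma>(\<beta> -
  3) / \<Gamma>(2k + \<beta>), divided by \<Gamma>(2k + 3) = (2k + 2)!. The hypothesis \<beta> > 3
  makes the second Beta argument positive.\<close>

lemma ml_term_has_integral:
  assumes "\<beta> > 3"
  shows "((\<lambda>u. u ^ (2 * k + 2) / fact (2 * k + 2) * (1 - u) powr (\<beta> - 4))
            has_integral Gamma (\<beta> - 3) * ml_coeff \<beta> k) {0..1}"
proof -
  have "((\<lambda>u. u powr (real (2 * k + 3) - 1) * (1 - u) powr ((\<beta> - 3) - 1))
          has_integral Beta (real (2 * k + 3)) (\<beta> - 3)) {0..1}"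
    using assms by (intro has_integral_Beta_real) auto
  from has_integral_divide[OF this, of "fact (2 * k + 2)"]
  have *: "((\<lambda>u. u powr (real (2 * k + 3) - 1) * (1 - u) powr ((\<beta> - 3) - 1) / fact (2 * k + 2))
          has_integral Beta (real (2 * k + 3)) (\<beta> - 3) / fact (2 * k + 2)) {0..1}" .
  have "Gamma (real (2 * k + 3)) = fact (2 * k + 2)"
    using Gamma_fact[of "2 * k + 2", where ?'a = real] by (simp add: algebra_simps del: fact_Suc)
  moreover have "real (2 * k + 3) + (\<beta> - 3) = 2 * real k + \<beta>" by simp
  ultimately have "Beta (real (2 * k + 3)) (\<beta> - 3) / fact (2 * k + 2) = Gamma (\<beta> - 3) * ml_coeff \<beta> k"
    unfolding Beta_def by (simp add: ml_coeff_def field_simps del: fact_Suc)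
  with * have "((\<lambda>u. u powr (real (2 * k + 3) - 1) * (1 - u) powr ((\<beta> - 3) - 1) / fact (2 * k + 2))
          has_integral Gamma (\<beta> - 3) * ml_coeff \<beta> k) {0..1}" by simp
  \<comment> \<open>The point u = 0 is treated apart: \<open>powr_realpow\<close> requires a
    positive base, and both sides are 0 there.\<close>
  moreover have "u powr (real (2 * k + 3) - 1) = u ^ (2 * k + 2)" if "u \<in> {0..1}" for u :: real
  proof -
    have exponent: "real (2 * k + 3) - 1 = real (2 * k + 2)" by simp
    show ?thesis
      using that powr_realpow[of u "2 * k + 2"] unfolding exponent by (cases "u = 0") auto
  qed
  ultimately show ?thesis
    by (subst (asm) has_integral_cong[where g = "\<lambda>u. u ^ (2 * k + 2) / fact (2 * k + 2) * (1 - u) powr (\<beta> - 4)"])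
       (simp_all del: fact_Suc)
qed

text \<open>Expand 1 - cos(yu) in powers of yu and integrate term by term, with dominated
  convergence for the partial sums. The lowest power being 2 accounts for the factor
  \<open>y\<^sup>2\<close>.\<close>

lemma real_ml_has_integral:
  assumes "\<beta> > 3" "y > 0"
  shows "((\<lambda>u. (1 - u) powr (\<beta> - 4) * (1 - cos (y * u)))
            has_integral Gamma (\<beta> - 3) * real_ml \<beta> (- (y\<^sup>2)) * y\<^sup>2) {0..1}"
proof -
  define w where "w u = (1 - u) powr (\<beta> - 4)" for u :: real
  define t where "t k u = (- 1) ^ k * (y * u) ^ (2 * k + 2) / fact (2 * k + 2)" for k and u :: real
  define C where "C = y\<^sup>2 * Gamma (\<beta> - 3)"
  have t_eq: "t k u * w u = (y\<^sup>2 * (- (y\<^sup>2)) ^ k) * (u ^ (2 * k + 2) / fact (2 * k + 2) * w u)" for k u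
  proof -
    have "(- (y\<^sup>2)) ^ k = (- 1) ^ k * y ^ (2 * k)"
      by (subst power_minus) (simp add: power_mult)
    then show ?thesis
      by (simp add: t_def power_mult_distrib power_add power2_eq_square mult_ac del: fact_Suc)
  qed
  have int_t: "((\<lambda>u. t k u * w u) has_integral C * (ml_coeff \<beta> k * (- (y\<^sup>2)) ^ k)) {0..1}" for k
    unfolding t_eq unfolding w_def
    using has_integral_mult_right[OF ml_term_has_integral[OF assms(1), of k], of "y\<^sup>2 * (- (y\<^sup>2)) ^ k"]
    by (simp add: C_def mult_ac del: fact_Suc)
  have int_p: "((\<lambda>u. (\<Sum>k<n. t k u) * w u) has_integral
      C * (\<Sum>k<n. ml_coeff \<beta> k * (- (y\<^sup>2)) ^ k)) {0..1}" for n
    unfolding sum_distrib_right sum_distrib_left by (intro has_integral_sum int_t) simp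
  have w_nonneg: "w u \<ge> 0" for u by (simp add: w_def)
  \<comment> \<open>By u \<le> 1 and (2k + 2)! \<ge> k!, the terms of the partial sums are dominated
    by those of the exponential series at \<open>y\<^sup>2\<close>, uniformly in n. The factor
    \<open>u ^ 2\<close> is kept so that the majorant is a multiple of the term k = 0.\<close>
  have bound: "norm ((\<Sum>k<n. t k u) * w u) \<le> exp (y\<^sup>2) * y\<^sup>2 * (u ^ 2 * w u)"
    if u: "u \<in> {0..1}" for n u
  proof -
    have "norm (t k u) \<le> y\<^sup>2 * u\<^sup>2 * ((y\<^sup>2) ^ k /\<^sub>R fact k)" for k
    proof -
      have "norm (t k u) = y\<^sup>2 * u\<^sup>2 * ((y\<^sup>2) ^ k * u ^ (2 * k) / fact (2 * k + 2))"
      proof -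
        have "y ^ (2 * k + 2) = y\<^sup>2 * (y\<^sup>2) ^ k" by (simp add: power_add power_mult power2_eq_square)
        moreover have "norm (t k u) = (y * u) ^ (2 * k + 2) / fact (2 * k + 2)"
          using u assms(2) by (simp add: t_def norm_mult norm_power abs_mult del: fact_Suc power_Suc)
        moreover have "u ^ (2 * k + 2) = u\<^sup>2 * u ^ (2 * k)" by (simp add: power_add power2_eq_square)
        ultimately show ?thesis by (simp only: power_mult_distrib mult_ac times_divide_eq_left times_divide_eq_right)
      qed
      also have "\<dots> \<le> y\<^sup>2 * u\<^sup>2 * ((y\<^sup>2) ^ k * 1 / fact k)"
        using u by (intro mult_left_mono frac_le mult_mono power_le_one fact_mono) auto
      finally show ?thesis by (simp add: field_simps)
    qed
    then have "norm (\<Sum>k<n. t k u) \<le> (\<Sum>k<n. y\<^sup>2 * u\<^sup>2 * ((y\<^sup>2) ^ k /\<^sub>R fact k))"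
      by (rule order_trans[OF norm_sum sum_mono])
    also have "\<dots> = y\<^sup>2 * u\<^sup>2 * (\<Sum>k<n. (y\<^sup>2) ^ k /\<^sub>R fact k)"
      by (simp add: sum_distrib_left)
    also have "\<dots> \<le> y\<^sup>2 * u\<^sup>2 * exp (y\<^sup>2)"
      unfolding exp_def by (intro mult_left_mono sum_le_suminf summable_exp_generic) auto
    finally have "norm (\<Sum>k<n. t k u) * w u \<le> y\<^sup>2 * u\<^sup>2 * exp (y\<^sup>2) * w u"
      using w_nonneg by (rule mult_right_mono)
    moreover have "norm (w u) = w u" using w_nonneg[of u] by simp
    ultimately show ?thesis by (simp only: norm_mult mult_ac)
  qed
  have dom: "(\<lambda>u. exp (y\<^sup>2) * y\<^sup>2 * (u ^ 2 * w u)) integrable_on {0..1}"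
  proof -
    \<comment> \<open>The term k = 0 of the previous lemma; the extra 2 cancels
      \<open>fact 2\<close>.\<close>
    have "(\<lambda>u. exp (y\<^sup>2) * y\<^sup>2 * 2 * (u ^ (2 * 0 + 2) / fact (2 * 0 + 2) * w u)) integrable_on {0..1}"
      unfolding w_def
      by (rule has_integral_integrable[OF has_integral_mult_right[OF ml_term_has_integral[OF assms(1)]]])
    moreover have "exp (y\<^sup>2) * y\<^sup>2 * 2 * (u ^ (2 * 0 + 2) / fact (2 * 0 + 2) * w u)
        = exp (y\<^sup>2) * y\<^sup>2 * (u ^ 2 * w u)" for u
      by (simp add: power2_eq_square)
    ultimately show ?thesis by (simp only:)
  qed
  have lim: "(\<lambda>n. (\<Sum>k<n. t k u) * w u) \<longlonglongrightarrow> w u * (1 - cos (y * u))" for u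
    using tendsto_mult_right[OF one_minus_cos_sums[of "y * u", unfolded sums_def], of "w u"]
    by (simp add: t_def mult.commute del: fact_Suc)
  note dc = dominated_convergence[OF has_integral_integrable[OF int_p] dom bound lim]
  have "(\<lambda>n. C * (\<Sum>k<n. ml_coeff \<beta> k * (- (y\<^sup>2)) ^ k)) \<longlonglongrightarrow> C * real_ml \<beta> (- (y\<^sup>2))"
    unfolding real_ml_def
    using summable_LIMSEQ[OF summable_ml[of \<beta> "- (y\<^sup>2)"]] assms by (intro tendsto_mult_left) simp
  then have "integral {0..1} (\<lambda>u. w u * (1 - cos (y * u))) = C * real_ml \<beta> (- (y\<^sup>2))"
    using dc(2) integral_unique[OF int_p] by (auto intro: LIMSEQ_unique)
  then show ?thesis
    using integrable_integral[OF dc(1)] by (simp add: w_def C_def mult_ac)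
qed

section \<open>Lower bound and positivity on the real line\<close>

text \<open>The integrand is nonnegative, so the integral may be cut down to [0, 1/2], away from u =
  1, where the weight tends to 0 if \<beta> > 4. The bound gives both positivity and the slow decay
  at -\<infinity>.\<close>

lemma real_ml_lower_bound:
  assumes "\<beta> > 3" "y > 0"
  shows "min 1 (2 powr (4 - \<beta>)) * (1 / 2 - sin (y / 2) / y) \<le> Gamma (\<beta> - 3) * real_ml \<beta> (- (y\<^sup>2)) * y\<^sup>2"
proof -
  define c where "c = min 1 (2 powr (4 - \<beta>))"
  \<comment> \<open>The antiderivative is \<open>u - sin (y * u) / y\<close>, with its endpoint
    values left unsimplified for the fundamental theorem.\<close>
  have int: "((\<lambda>u. c * (1 - cos (y * u))) has_integral
      c * ((1 / 2 - sin (y * (1 / 2)) / y) - (0 - sin (y * 0) / y))) {0..1 / 2}"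
    using assms
    by (intro has_integral_mult_right fundamental_theorem_of_calculus)
       (auto intro!: derivative_eq_intros simp: has_real_derivative_iff_has_vector_derivative[symmetric])
  \<comment> \<open>The weight is at least 1 if \<beta> \<le> 4, and otherwise at least its value at
    u = 1/2; \<open>c\<close> covers both cases.\<close>
  have c_le: "c \<le> (1 - u) powr (\<beta> - 4)" if "u \<in> {0..1/2}" for u
  proof (cases "\<beta> \<le> 4")
    case True
    then have "1 powr (\<beta> - 4) \<le> (1 - u) powr (\<beta> - 4)"
      using that by (intro powr_mono2') auto
    then show ?thesis by (simp add: c_def)
  next
    case False
    then have "(1 / 2) powr (\<beta> - 4) \<le> (1 - u) powr (\<beta> - 4)"
      using that by (intro powr_mono2) auto
    moreover have "(1 / 2) powr (\<beta> - 4) = 2 powr (4 - \<beta>)"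
      by (simp add: powr_divide powr_minus_divide[symmetric])
    ultimately show ?thesis by (simp add: c_def)
  qed
  have half: "(\<lambda>u. (1 - u) powr (\<beta> - 4) * (1 - cos (y * u))) integrable_on {0..1/2}"
    using has_integral_integrable[OF real_ml_has_integral[OF assms]]
    by (rule integrable_on_subinterval) auto
  have "integral {0..1/2} (\<lambda>u. c * (1 - cos (y * u)))
      \<le> integral {0..1/2} (\<lambda>u. (1 - u) powr (\<beta> - 4) * (1 - cos (y * u)))"
    using c_le by (intro integral_le has_integral_integrable[OF int] half mult_right_mono) auto
  also have "\<dots> \<le> integral {0..1} (\<lambda>u. (1 - u) powr (\<beta> - 4) * (1 - cos (y * u)))"
    using has_integral_integrable[OF real_ml_has_integral[OF assms]]
    by (intro integral_subset_le half) auto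
  also have "\<dots> = Gamma (\<beta> - 3) * real_ml \<beta> (- (y\<^sup>2)) * y\<^sup>2"
    by (rule integral_unique[OF real_ml_has_integral[OF assms]])
  finally show ?thesis unfolding integral_unique[OF int] by (simp add: c_def)
qed

text \<open>Strictness comes from halving: sin x = 2 sin h cos h with h = x/2, where |sin h| \<le>
  h, and |cos h| < 1 unless sin h = 0.\<close>

lemma sin_less_self:
  fixes x :: real
  assumes "x > 0"
  shows "sin x < x"
proof -
  define h where "h = x / 2"
  have h: "h > 0" "x = 2 * h" using assms by (simp_all add: h_def)
  have "sin h * cos h < h"
  proof (cases "sin h = 0")
    case False
    then have "(cos h)\<^sup>2 < 1" by (simp add: cos_squared_eq)
    then have "\<bar>cos h\<bar> < 1" by (simp add: abs_square_less_1)
    with False have "\<bar>sin h\<bar> * \<bar>cos h\<bar> < \<bar>sin h\<bar>" by simp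
    also have "\<dots> \<le> h" using abs_sin_x_le_abs_x[of h] h by simp
    finally show ?thesis by (simp flip: abs_mult)
  qed (use h in simp)
  then show ?thesis using sin_double[of h] by (simp add: h(2))
qed

lemma real_ml_pos:
  assumes "\<beta> > 3"
  shows "real_ml \<beta> x > 0"
proof (cases "x \<ge> 0")
  case True
  then show ?thesis using assms by (intro real_ml_pos_nonneg) auto
next
  case False
  define y where "y = sqrt (- x)"
  have y: "y > 0" "x = - (y\<^sup>2)" using False by (auto simp: y_def)
  have "0 < min 1 (2 powr (4 - \<beta>)) * (1 / 2 - sin (y / 2) / y)"
    using sin_less_self[of "y / 2"] y(1) by (intro mult_pos_pos) (auto simp: field_simps)
  also note real_ml_lower_bound[OF assms y(1)]
  finally have "Gamma (\<beta> - 3) * real_ml \<beta> (- (y\<^sup>2)) > 0"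
    by (rule zero_less_mult_pos2) (use y in simp)
  then have "real_ml \<beta> (- (y\<^sup>2)) > 0"
    by (rule zero_less_mult_pos) (use assms in simp)
  then show ?thesis by (simp only: y)
qed

section \<open>From the modulus inequality to log-concavity and exponential decay\<close>

text \<open>Were d negative, f' would be negative just to the right of 0, and f would fall below its
  minimum.\<close>

lemma second_derivative_nonneg_at_min:
  fixes f f' :: "real \<Rightarrow> real"
  assumes f: "\<And>x. (f has_real_derivative f' x) (at x)"
    and f': "(f' has_real_derivative d) (at 0)" "f' 0 = 0"
    and min: "\<And>x. f 0 \<le> f x"
  shows "d \<ge> 0"
proof (rule ccontr)
  assume "\<not> d \<ge> 0"
  then obtain e where e: "e > 0" "\<And>h. h > 0 \<Longrightarrow> h < e \<Longrightarrow> f' h < 0"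
    using DERIV_neg_dec_right[OF f'(1)] f'(2) by auto
  have "f (e/2) < f 0"
    by (rule DERIV_neg_imp_decreasing_open)
       (use e f in \<open>auto intro: DERIV_continuous_on has_field_derivative_at_within\<close>, fastforce)
  with min[of "e/2"] show False by simp
qed

text \<open>On the vertical line through \<open>x\<close> the function \<open>y \<mapsto> |f (x + iy)|\<^sup>2 = f (x + iy) f (x - iy)\<close>
  is minimal at \<open>y = 0\<close>, where its second derivative is \<open>2 (f' x)\<^sup>2 - 2 f x f'' x\<close>.\<close>
lemma log_concave_of_norm_ge:
  fixes a :: "nat \<Rightarrow> real"
  assumes summ: "\<And>z::complex. summable (\<lambda>k. of_real (a k) * z ^ k)"
  defines "F \<equiv> \<lambda>b x::real. \<Sum>k. b k * x ^ k"
  assumes pos: "\<And>x. F a x > 0"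
    and ge: "\<And>z::complex. cmod (\<Sum>k. of_real (a k) * z ^ k) \<ge> F a (Re z)"
  shows "F a x * F (diffs (diffs a)) x \<le> (F (diffs a) x)\<^sup>2"
proof -
  define f where "f b z = (\<Sum>k. of_real (b k) * z ^ k)" for b and z :: complex
  have summ': "summable (\<lambda>k. of_real (diffs a k) * z ^ k)" for z :: complex
    using termdiff_converges_all[OF summ] by (simp add: diffs_of_real)
  have summ'': "summable (\<lambda>k. of_real (diffs (diffs a) k) * z ^ k)" for z :: complex
    using termdiff_converges_all[OF summ'] by (simp add: diffs_of_real)
  have f_real: "f b (of_real x) = of_real (F b x)"
    if "\<And>z::complex. summable (\<lambda>k. of_real (b k) * z ^ k)" for b x
  proof -
    have "summable (\<lambda>k. b k * x ^ k)"
      using summable_Re[OF that[of "of_real x"]] by (simp flip: of_real_power of_real_mult)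
    from suminf_of_real[OF this, where ?'a = complex] show ?thesis
      by (simp add: f_def F_def)
  qed
  have f_cnj: "f b (cnj z) = cnj (f b z)"
    if "\<And>z::complex. summable (\<lambda>k. of_real (b k) * z ^ k)" for b z
    using bounded_linear.suminf[OF bounded_linear_cnj that[of z]] by (simp add: f_def)
  have df: "(f a has_field_derivative f (diffs a) z) (at z)" for z
    using termdiffs_strong_converges_everywhere[OF summ, of z]
    by (simp add: f_def[abs_def] diffs_of_real)
  have df': "(f (diffs a) has_field_derivative f (diffs (diffs a)) z) (at z)" for z
    using termdiffs_strong_converges_everywhere[OF summ', of z]
    by (simp add: f_def[abs_def] diffs_of_real)
  define X where "X = complex_of_real x"
  \<comment> \<open>\<open>P\<close> takes a complex argument so that the complex chain rule yields
    both derivatives; real arguments are substituted only afterwards.\<close>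
  define P where "P w = f a (X + \<i> * w) * f a (X - \<i> * w)" for w
  define P' where "P' w = \<i> * f (diffs a) (X + \<i> * w) * f a (X - \<i> * w)
      - \<i> * f a (X + \<i> * w) * f (diffs a) (X - \<i> * w)" for w
  define d where "d = 2 * (f (diffs a) X)\<^sup>2 - 2 * f a X * f (diffs (diffs a)) X"
  have dP: "(P has_field_derivative P' w) (at w)" for w
    unfolding P_def[abs_def] P'_def
    by (auto intro!: derivative_eq_intros DERIV_chain2[OF df] simp: algebra_simps)
  have dP': "(P' has_field_derivative d) (at 0)"
    unfolding P'_def[abs_def] d_def
    by (auto intro!: derivative_eq_intros DERIV_chain2[OF df] DERIV_chain2[OF df']
          simp: algebra_simps power2_eq_square)
  have Re_deriv: "((\<lambda>r. Re (g (of_real r))) has_real_derivative Re g') (at r)"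
    if "(g has_field_derivative g') (at (of_real r))" for g g' r
    using bounded_linear.has_vector_derivative[OF bounded_linear_Re has_vector_derivative_real_field[OF that]]
    by (simp add: has_real_derivative_iff_has_vector_derivative)
  have P_norm: "Re (P (of_real r)) = (cmod (f a (X + \<i> * of_real r)))\<^sup>2" for r
  proof -
    \<comment> \<open>Since the coefficients are real, f commutes with conjugation, so the two
      factors of \<open>P\<close> are conjugate at real arguments.\<close>
    have "X - \<i> * of_real r = cnj (X + \<i> * of_real r)" by (simp add: X_def)
    then have "P (of_real r) = of_real ((cmod (f a (X + \<i> * of_real r)))\<^sup>2)"
      unfolding P_def by (simp only: f_cnj[OF summ] complex_norm_square)
    then show ?thesis by simp
  qed
  have "0 \<le> Re d"
  proof (rule second_derivative_nonneg_at_min)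
    show "((\<lambda>r. Re (P (of_real r))) has_real_derivative Re (P' (of_real r))) (at r)" for r
      by (rule Re_deriv[OF dP])
    show "((\<lambda>r. Re (P' (of_real r))) has_real_derivative Re d) (at 0)"
      by (rule Re_deriv) (use dP' in simp)
    show "Re (P' (of_real 0)) = 0" by (simp add: P'_def)
    show "Re (P (of_real 0)) \<le> Re (P (of_real r))" for r
    proof -
      have "F a x \<le> cmod (f a (X + \<i> * of_real r))"
        using ge[of "X + \<i> * of_real r"] by (simp add: f_def X_def)
      then show ?thesis
        unfolding P_norm using pos[of x] by (simp add: X_def f_real[OF summ] power_mono)
    qed
  qed
  also have "d = of_real (2 * (F (diffs a) x)\<^sup>2 - 2 * F a x * F (diffs (diffs a)) x)"
    by (simp add: d_def X_def f_real[OF summ] f_real[OF summ'] f_real[OF summ''])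
  finally show ?thesis by simp
qed

text \<open>The graph of ln f lies below its tangent at 0. Concretely, f'/f is nonincreasing, so f'
  \<ge> c f to the left of 0 with c = f'(0)/f(0), and f(t) exp(-ct) is nondecreasing there.\<close>

lemma log_concave_decay:
  fixes f f' f'' :: "real \<Rightarrow> real"
  assumes f: "\<And>x. (f has_real_derivative f' x) (at x)"
    and f': "\<And>x. (f' has_real_derivative f'' x) (at x)"
    and pos: "\<And>x. f x > 0"
    and lc: "\<And>x. f x * f'' x \<le> (f' x)\<^sup>2"
    and x: "x \<le> 0"
  shows "f x \<le> f 0 * exp (f' 0 / f 0 * x)"
proof -
  define c where "c = f' 0 / f 0"
  have q: "c * f t \<le> f' t" if "t \<le> 0" for t
  proof -
    have "f' t / f t \<ge> f' 0 / f 0"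
    proof (rule DERIV_nonpos_imp_nonincreasing[OF that])
      fix s
      have "((\<lambda>s. f' s / f s) has_real_derivative (f'' s * f s - f' s * f' s) / (f s * f s)) (at s)"
        using pos[of s] by (intro DERIV_divide f f') auto
      moreover have "(f'' s * f s - f' s * f' s) / (f s * f s) \<le> 0"
        using lc[of s] by (intro divide_nonpos_nonneg) (auto simp: power2_eq_square mult.commute)
      ultimately show "\<exists>d. ((\<lambda>s. f' s / f s) has_real_derivative d) (at s) \<and> d \<le> 0" by blast
    qed
    then show ?thesis using pos[of t] by (simp add: c_def[symmetric] pos_le_divide_eq)
  qed
  have "f x * exp (- c * x) \<le> f 0 * exp (- c * 0)"
  proof (rule DERIV_nonneg_imp_nondecreasing[OF x])
    fix t :: real assume t: "t \<le> 0"
    have "((\<lambda>t. f t * exp (- c * t)) has_real_derivative (f' t - c * f t) * exp (- c * t)) (at t)"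
      by (auto intro!: derivative_eq_intros f simp: algebra_simps)
    moreover have "(f' t - c * f t) * exp (- c * t) \<ge> 0"
      using q[OF t] by simp
    ultimately show "\<exists>d. ((\<lambda>t. f t * exp (- c * t)) has_real_derivative d) (at t) \<and> d \<ge> 0"
      by blast
  qed
  then show ?thesis by (simp add: c_def[symmetric] exp_minus field_simps)
qed

section \<open>Failure of the modulus inequality\<close>

lemma not_norm_ge:
  assumes "\<beta> > 3"
  shows "\<not> (\<forall>z. cmod (mittag_leffler2 \<beta> z) \<ge> Re (mittag_leffler2 \<beta> (of_real (Re z))))"
proof
  assume ge: "\<forall>z. cmod (mittag_leffler2 \<beta> z) \<ge> Re (mittag_leffler2 \<beta> (of_real (Re z)))"
  have \<beta>: "\<beta> > 0" using assms by simp
  define a where "a = ml_coeff \<beta>"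
  define F where "F b x = (\<Sum>k. b k * x ^ k)" for b and x :: real
  have F_a: "F a = real_ml \<beta>" by (simp add: F_def a_def real_ml_def fun_eq_iff)
  have summ: "summable (\<lambda>k. a k * x ^ k)" for x :: real
    using summable_ml[OF \<beta>, of x] by (simp add: a_def)
  have lc: "F a x * F (diffs (diffs a)) x \<le> (F (diffs a) x)\<^sup>2" for x
    unfolding F_def
  proof (rule log_concave_of_norm_ge)
    show "summable (\<lambda>k. of_real (a k) * z ^ k)" for z :: complex
      unfolding a_def by (rule summable_ml[OF \<beta>])
    show "(\<Sum>k. a k * x ^ k) > 0" for x
      using real_ml_pos[OF assms, of x] by (simp add: a_def real_ml_def)
    show "(\<Sum>k. a k * Re z ^ k) \<le> cmod (\<Sum>k. of_real (a k) * z ^ k)" for z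
      using ge[rule_format, of z] unfolding mittag_leffler2_of_real[OF \<beta>]
      by (simp add: mittag_leffler2_eq real_ml_def a_def)
  qed
  have dF: "(F a has_real_derivative F (diffs a) x) (at x)" for x
    unfolding F_def[abs_def] by (rule termdiffs_strong_converges_everywhere[OF summ])
  have dF': "(F (diffs a) has_real_derivative F (diffs (diffs a)) x) (at x)" for x
    unfolding F_def[abs_def]
    by (rule termdiffs_strong_converges_everywhere[OF termdiff_converges_all[OF summ]])
  define c where "c = F (diffs a) 0 / F a 0"
  have F0: "F b 0 = b 0" for b unfolding F_def by (rule powser_zero)
  \<comment> \<open>\<open>c\<close> is the quotient of the coefficients with indices 1 and 0, both
    positive.\<close>
  have c: "c > 0" unfolding c_def F0 by (simp add: diffs_def a_def ml_coeff_pos \<beta>)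
  have upper: "real_ml \<beta> (- s) \<le> real_ml \<beta> 0 * exp (- c * s)" if "s \<ge> 0" for s
    using log_concave_decay[OF dF dF' _ lc, of "- s"] that real_ml_pos[OF assms]
    by (simp add: F_a c_def)
  \<comment> \<open>The factor 1/4 bounds \<open>1 / 2 - sin (y / 2) / y\<close> from below once y
    \<ge> 4, by sin \<le> 1.\<close>
  define K where "K = min 1 (2 powr (4 - \<beta>)) * (1 / 4)"
  have K: "K > 0" by (simp add: K_def)
  have lower: "K \<le> Gamma (\<beta> - 3) * real_ml \<beta> 0 * (exp (- c * y\<^sup>2) * y\<^sup>2)" if y: "y \<ge> 4" for y
  proof -
    have "4 * sin (y / 2) \<le> y" using y sin_le_one[of "y / 2"] by linarith
    then have "sin (y / 2) / y \<le> 1 / 4" using y by (simp add: field_simps)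
    then have "K \<le> min 1 (2 powr (4 - \<beta>)) * (1 / 2 - sin (y / 2) / y)"
      unfolding K_def by (intro mult_left_mono) auto
    also have "\<dots> \<le> Gamma (\<beta> - 3) * real_ml \<beta> (- (y\<^sup>2)) * y\<^sup>2"
      using assms y by (intro real_ml_lower_bound) auto
    also have "\<dots> \<le> Gamma (\<beta> - 3) * (real_ml \<beta> 0 * exp (- c * y\<^sup>2)) * y\<^sup>2"
      using upper[of "y\<^sup>2"] assms by (intro mult_right_mono mult_left_mono) auto
    finally show ?thesis by (simp add: mult_ac)
  qed
  \<comment> \<open>At x = -\<open>y\<^sup>2\<close> the lower bound multiplied by
    \<open>y\<^sup>2\<close> stays above \<open>K\<close>, while the exponential upper bound
    multiplied by \<open>y\<^sup>2\<close> vanishes in the limit.\<close>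
  have "((\<lambda>y. exp (- c * y\<^sup>2) * y\<^sup>2) \<longlongrightarrow> 0) at_top" using c by real_asymp
  from tendsto_mult_right_zero[OF this]
  have "((\<lambda>y. Gamma (\<beta> - 3) * real_ml \<beta> 0 * (exp (- c * y\<^sup>2) * y\<^sup>2)) \<longlongrightarrow> 0) at_top" .
  then have "K \<le> 0"
    by (rule tendsto_lowerbound) (use lower in \<open>auto simp: eventually_at_top_linorder\<close>)
  with K show False by simp
qed

theorem proposition19:
  fixes \<beta> :: real
  shows "(\<beta> \<ge> 4 \<longrightarrow>
            (\<forall>x::real. mittag_leffler2 \<beta> (of_real x) \<in> \<real> \<and> Re (mittag_leffler2 \<beta> (of_real x)) > 0) \<and>
            (\<forall>z::complex. mittag_leffler2 \<beta> z = 0 \<longrightarrow> z \<notin> \<real>) \<and>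
            \<not> (\<forall>z::complex. cmod (mittag_leffler2 \<beta> z) \<ge> Re (mittag_leffler2 \<beta> (of_real (Re z))))) \<and>
         (\<beta> \<in> {3<..<4} \<longrightarrow>
            finite {x::real. x < 0 \<and> mittag_leffler2 \<beta> (of_real x) = 0} \<and>
            \<not> (\<forall>z::complex. cmod (mittag_leffler2 \<beta> z) \<ge> Re (mittag_leffler2 \<beta> (of_real (Re z)))))"
proof -
  have real: "mittag_leffler2 \<beta> (of_real x) = of_real (real_ml \<beta> x)" and pos: "real_ml \<beta> x > 0"
    if "\<beta> > 3" for x
    using that mittag_leffler2_of_real[of \<beta>] real_ml_pos[of \<beta>] by auto
  have nz: "z \<notin> \<real>" if "\<beta> > 3" "mittag_leffler2 \<beta> z = 0" for z
    using that real pos by (metis Reals_cases less_irrefl of_real_eq_0_iff)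
  \<comment> \<open>Finiteness in case (b) holds because there are no negative zeros.\<close>
  then have empty: "{x::real. x < 0 \<and> mittag_leffler2 \<beta> (of_real x) = 0} = {}" if "\<beta> > 3"
    using that by (metis (mono_tags, lifting) Collect_empty_eq Reals_of_real)
  show ?thesis
  proof (intro conjI impI)
    assume "\<beta> \<in> {3<..<4}"
    then show "finite {x::real. x < 0 \<and> mittag_leffler2 \<beta> (of_real x) = 0}"
      by (subst empty) auto
  qed (use real pos nz not_norm_ge[of \<beta>] in auto)
qed

end
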